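(* For every function $f:\mathbb{N}\to\mathbb{N}$ satisfying $f(n)\le n^{1.5}$ for all $n$, there is a family of connected graphs $\{G_n\}_{n\in\mathbb{N}}$ such that $G_n$ has $n$ vertices and $\mathrm{AC}(G_n)=\Theta(f(n))$.
   Context: Acquaintance time: let $G=(V,E)$ be a finite, simple, undirected, connected graph, and place one agent on each vertex. Two agents are acquainted once they occupy the two endpoints of a common edge at some time (including the initial placement). In each round one chooses a matching $M$ of $G$ (any set of pairwise vertex-disjoint edges, not necessarily maximal), and for every edge of $M$ the two agents on its endpoints swap places; after each round, agents on adjacent vertices again become acquainted. A sequence of matchings is a strategy; a strategy for acquaintance is one after which every pair of agents has been acquainted. $\mathrm{AC}(G)$ is the minimum number of rounds (matchings) in a strategy for acquaintance in $G$. *)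

theory Defs
  imports "Graph_Theory.Graph_Theory" "HOL-Library.Landau_Symbols"
begin

text \<open>
  A finite simple undirected graph is a \<^locale>\<open>pair_graph\<close>: an undirected edge is represented by
  its two opposite arcs. Edges occurring in matchings are two-element sets of vertices.
\<close>

definition uedges :: "'a pair_pre_digraph \<Rightarrow> 'a set set" where
  "uedges G = {{u, v} | u v. (u, v) \<in> parcs G}"

definition matching :: "'a pair_pre_digraph \<Rightarrow> 'a set set \<Rightarrow> bool" where
  "matching G M \<longleftrightarrow> M \<subseteq> uedges G \<and> pairwise disjnt M"

text \<open>
  The vertex to which the agent standing at \<open>v\<close> moves when the agents are swapped along all edges
  of \<open>M\<close>. If \<open>M\<close> is a matching of a loopfree graph, the description below is unique.
\<close>

definition swap_along :: "'a set set \<Rightarrow> 'a \<Rightarrow> 'a" where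
  "swap_along M v = (if v \<in> \<Union>M then THE w. {v, w} \<in> M else v)"

text \<open>
  Agents are named by their initial vertices: \<open>position Ms t a\<close> is the vertex occupied, after the
  first \<open>t\<close> rounds of \<open>Ms\<close>, by the agent that started at \<open>a\<close>.
\<close>

definition position :: "'a set set list \<Rightarrow> nat \<Rightarrow> 'a \<Rightarrow> 'a" where
  "position Ms t a = fold swap_along (take t Ms) a"

definition acquainted :: "'a pair_pre_digraph \<Rightarrow> 'a set set list \<Rightarrow> 'a \<Rightarrow> 'a \<Rightarrow> bool" where
  "acquainted G Ms a b \<longleftrightarrow> (\<exists>t\<le>length Ms. (position Ms t a, position Ms t b) \<in> parcs G)"

definition strategy :: "'a pair_pre_digraph \<Rightarrow> 'a set set list \<Rightarrow> bool" where
  "strategy G Ms \<longleftrightarrow> (\<forall>M\<in>set Ms. matching G M)"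

definition acquaintance_strategy :: "'a pair_pre_digraph \<Rightarrow> 'a set set list \<Rightarrow> bool" where
  "acquaintance_strategy G Ms \<longleftrightarrow>
     strategy G Ms \<and> (\<forall>a\<in>pverts G. \<forall>b\<in>pverts G. a \<noteq> b \<longrightarrow> acquainted G Ms a b)"

text \<open>
  The minimum exists for every finite connected graph, since any agent can be walked along a path
  to any other one; \<open>AC\<close> is only meaningful for such graphs.
\<close>

definition AC :: "'a pair_pre_digraph \<Rightarrow> nat" where
  "AC G = (LEAST k. \<exists>Ms. length Ms = k \<and> acquaintance_strategy G Ms)"

end

theory Submission
  imports Defs "HOL-Combinatorics.Transposition"
begin

text \<open>
  If \<open>f n < n\<close>, take a clique with \<open>f n\<close> pendant vertices at one of its vertices \<open>0\<close>. Stepping to \<open>0\<close>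
  acquaints an agent with everyone, while two agents that have never left their pendant vertices have
  not met, and at most one agent leaves per round.

  If \<open>f n \<ge> n\<close>, take cliques of size \<open>s\<close>, about \<open>n\<^sup>2 / f n\<close>, each joined by a single edge to a hub.
  Sending every agent to every clique and back takes at most \<open>6n (n / s + 1)\<close> rounds. Conversely, a
  round moves one agent into the hub and one out of it, which creates \<open>O(s + n / s)\<close> new acquaintances;
  since \<open>s\<close> is at least of order \<open>\<surd>n\<close>, all \<open>n (n - 1)\<close> of them need a number of rounds of order
  \<open>n\<^sup>2 / s\<close>.
\<close>

section \<open>Matchings and positions\<close>

lemma doubleton_in_matching_unique:
  assumes "matching G M" "{u, v} \<in> M" "{u, w} \<in> M"
  shows "v = w"
proof -
  have "{u, v} = {u, w}"
    using assms unfolding matching_def pairwise_def disjnt_def by (metis IntI empty_iff insertI1)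
  then show ?thesis
    by (auto simp: doubleton_eq_iff)
qed

lemma swap_along_eq:
  assumes "matching G M" "{u, v} \<in> M"
  shows "swap_along M u = v"
proof -
  have "(THE w. {u, w} \<in> M) = v"
    using assms doubleton_in_matching_unique[OF assms(1)] by (intro the_equality) auto
  moreover have "u \<in> \<Union>M"
    using assms by auto
  ultimately show ?thesis
    by (simp add: swap_along_def)
qed

lemma swap_along_cases:
  assumes "matching G M"
  obtains "swap_along M v = v" | "{v, swap_along M v} \<in> M"
proof (cases "v \<in> \<Union>M")
  case True
  then obtain e where e: "v \<in> e" "e \<in> M"
    by auto
  with assms obtain w where "e = {v, w}"
    unfolding matching_def uedges_def by blast
  with e have "{v, w} \<in> M"
    by simp
  with that(2) swap_along_eq[OF assms this] show ?thesis
    by simp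
next
  case False
  with that(1) show ?thesis
    by (simp add: swap_along_def)
qed

lemma swap_along_involution:
  assumes "matching G M"
  shows "swap_along M (swap_along M v) = v"
  using assms
proof (cases rule: swap_along_cases[where v = v])
  case 2
  then show ?thesis
    using assms by (intro swap_along_eq) (simp_all add: insert_commute)
qed simp

lemma inj_swap_along: "matching G M \<Longrightarrow> inj (swap_along M)"
  by (metis injI swap_along_involution)

lemma (in pair_graph) matching_arc:
  assumes "matching G M" "{u, v} \<in> M"
  shows "(u, v) \<in> parcs G"
  using assms arcs_symmetric unfolding matching_def uedges_def
  by (auto simp: doubleton_eq_iff dest!: subsetD)

lemma (in pair_graph) swap_along_in_pverts:
  assumes "matching G M" "v \<in> pverts G"
  shows "swap_along M v \<in> pverts G"
  using assms(1)
proof (cases rule: swap_along_cases[where v = v])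
  case 2
  then show ?thesis
    by (rule in_arcsD2[OF matching_arc[OF assms(1)]])
qed (use assms(2) in simp)

lemma position_0 [simp]: "position Ms 0 a = a"
  by (simp add: position_def)

lemma position_Suc:
  "t < length Ms \<Longrightarrow> position Ms (Suc t) a = swap_along (Ms ! t) (position Ms t a)"
  by (simp add: position_def take_Suc_conv_app_nth)

lemma inj_position:
  assumes "strategy G Ms" "t \<le> length Ms"
  shows "inj (position Ms t)"
  using assms(2)
proof (induction t)
  case 0
  then show ?case
    by (simp add: inj_def)
next
  case (Suc t)
  then have "inj (swap_along (Ms ! t))"
    using assms(1) inj_swap_along by (fastforce simp: strategy_def)
  moreover have "inj (position Ms t)"
    using Suc by simp
  moreover have "position Ms (Suc t) = swap_along (Ms ! t) \<circ> position Ms t"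
    using Suc.prems by (simp add: fun_eq_iff position_Suc)
  ultimately show ?case
    by (simp only: inj_compose)
qed

lemma (in pair_graph) position_in_pverts:
  assumes "strategy G Ms" "t \<le> length Ms" "a \<in> pverts G"
  shows "position Ms t a \<in> pverts G"
  using assms(2)
proof (induction t)
  case 0
  then show ?case
    using assms(3) by simp
next
  case (Suc t)
  then show ?case
    using assms(1) swap_along_in_pverts by (simp add: position_Suc strategy_def)
qed

lemma (in pair_graph) acquainted_sym: "acquainted G Ms a b \<Longrightarrow> acquainted G Ms b a"
  unfolding acquainted_def using arcs_symmetric by blast

lemma acquaintedI_adjacent: "(a, b) \<in> parcs G \<Longrightarrow> acquainted G Ms a b"
  unfolding acquainted_def by (intro exI[of _ 0]) simp

lemma AC_le: "acquaintance_strategy G Ms \<Longrightarrow> AC G \<le> length Ms"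
  unfolding AC_def by (rule Least_le) blast

text \<open>\<open>LEAST\<close> is attained only when some acquaintance strategy exists, so each
  lower bound on \<open>AC\<close> first supplies one.\<close>

lemma obtain_optimal_strategy:
  assumes "acquaintance_strategy G Ms"
  obtains Ms' where "acquaintance_strategy G Ms'" "length Ms' = AC G"
proof -
  have "\<exists>k Ms'. length Ms' = k \<and> acquaintance_strategy G Ms'"
    using assms by blast
  from LeastI_ex[OF this] that show ?thesis
    unfolding AC_def by blast
qed

section \<open>Excursions\<close>

text \<open>For u = v the result is an idle round, so an agent that already stands at its port or at
  the hub can follow the general itinerary.\<close>

definition single_swap :: "'a \<Rightarrow> 'a \<Rightarrow> 'a set set" where
  "single_swap u v = (if u = v then {} else {{u, v}})"

lemma swap_along_single_swap: "swap_along (single_swap u v) = transpose u v"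
proof (cases "u = v")
  case True
  then show ?thesis
    by (auto simp: single_swap_def swap_along_def)
next
  case False
  have "(THE w. {u, w} = {u, v}) = v" "(THE w. {v, w} = {u, v}) = u"
    by (auto intro!: the_equality simp: doubleton_eq_iff)
  with False show ?thesis
    by (auto simp: single_swap_def swap_along_def fun_eq_iff transpose_def)
qed

lemma matching_single_swap: "u = v \<or> (u, v) \<in> parcs G \<Longrightarrow> matching G (single_swap u v)"
  by (auto simp: single_swap_def matching_def uedges_def)

lemma fold_concat_eq_id:
  "\<forall>E\<in>set Es. fold f E = id \<Longrightarrow> fold f (concat Es) = id"
  by (induction Es) auto

text \<open>Each block restores the initial placement, so every block starts with all agents at home
  and can be analysed in isolation.\<close>

lemma acquainted_concat:
  assumes "\<forall>E\<in>set Es. fold swap_along E = id" "E \<in> set Es" "acquainted G E a b"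
  shows "acquainted G (concat Es) a b"
proof -
  obtain xs ys where Es: "Es = xs @ E # ys"
    using assms(2) by (meson split_list)
  have "fold swap_along (concat xs) = id"
    using assms(1) Es by (intro fold_concat_eq_id) auto
  then have pos: "position (concat Es) (length (concat xs) + t) x = position E t x"
    if "t \<le> length E" for t x
    using that unfolding position_def Es by simp
  obtain t where "t \<le> length E" "(position E t a, position E t b) \<in> parcs G"
    using assms(3) unfolding acquainted_def by blast
  then show ?thesis
    unfolding acquainted_def
    by (intro exI[of _ "length (concat xs) + t"]) (simp only: pos, simp add: Es)
qed

lemma (in pair_graph) acquaintance_strategy_concat:
  assumes "\<And>E. E \<in> set Es \<Longrightarrow> strategy G E \<and> fold swap_along E = id"
    and "\<And>a b. \<lbrakk>a \<in> pverts G; b \<in> pverts G; a \<noteq> b; (a, b) \<notin> parcs G\<rbrakk> \<Longrightarrow>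
           \<exists>E\<in>set Es. acquainted G E a b \<or> acquainted G E b a"
  shows "acquaintance_strategy G (concat Es)"
  unfolding acquaintance_strategy_def
proof (intro conjI ballI impI)
  show "strategy G (concat Es)"
    using assms(1) by (auto simp: strategy_def)
  fix a b assume "a \<in> pverts G" "b \<in> pverts G" "a \<noteq> b"
  then show "acquainted G (concat Es) a b"
    using assms acquainted_concat acquainted_sym acquaintedI_adjacent by metis
qed

section \<open>Counting acquaintances\<close>

text \<open>Every ordered pair of distinct agents must be adjacent at some time. The arcs pay for
  the pairs adjacent at time 0, and each round creates at most d further adjacent pairs.\<close>

lemma (in pair_graph) card_pairs_le:
  assumes acq: "acquaintance_strategy G Ms"
    and new: "\<And>M. matching G M \<Longrightarrow>
      card {(u, v) \<in> parcs G. (swap_along M u, swap_along M v) \<notin> parcs G} \<le> d"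
  shows "card (pverts G) * (card (pverts G) - 1) \<le> card (parcs G) + length Ms * d"
proof -
  define A where "A t = {(a, b). a \<in> pverts G \<and> b \<in> pverts G \<and>
    (position Ms t a, position Ms t b) \<in> parcs G}" for t
  have strat: "strategy G Ms"
    using acq by (simp add: acquaintance_strategy_def)
  have fin: "finite (A t)" for t
    by (rule finite_subset[of _ "pverts G \<times> pverts G"]) (auto simp: A_def pair_finite_verts)
  have step: "card (A (Suc t) - A t) \<le> d" if t: "t < length Ms" for t
  proof -
    let ?N = "{(u, v) \<in> parcs G. (swap_along (Ms ! t) u, swap_along (Ms ! t) v) \<notin> parcs G}"
    have m: "matching G (Ms ! t)"
      using strat t by (simp add: strategy_def)
    \<comment> \<open>Send a pair to its positions after round t. Because the matching acts as an
      involution, applying it once more gives the positions before the round, which form no arc for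
      a new pair. Positions are injective, so no pair is lost.\<close>
    have "card (A (Suc t) - A t) \<le> card ?N"
    proof (rule card_inj_on_le)
      have "inj (position Ms (Suc t))"
        using strat t by (intro inj_position) auto
      then show "inj_on (map_prod (position Ms (Suc t)) (position Ms (Suc t))) (A (Suc t) - A t)"
        using prod.inj_map inj_on_subset by blast
      show "map_prod (position Ms (Suc t)) (position Ms (Suc t)) ` (A (Suc t) - A t) \<subseteq> ?N"
        using t by (auto simp: A_def position_Suc swap_along_involution[OF m])
      show "finite ?N"
        by (rule finite_subset[OF _ pair_finite_arcs]) auto
    qed
    with new[OF m] show ?thesis
      by simp
  qed
  have union: "card (\<Union>i\<le>t. A i) \<le> card (parcs G) + t * d" if "t \<le> length Ms" for t
    using that
  proof (induction t)
    case 0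
    have "A 0 \<subseteq> parcs G"
      by (auto simp: A_def)
    then show ?case
      by (simp add: card_mono pair_finite_arcs)
  next
    case (Suc t)
    have "(\<Union>i\<le>Suc t. A i) = (\<Union>i\<le>t. A i) \<union> (A (Suc t) - A t)"
      by (auto simp: atMost_Suc)
    then have "card (\<Union>i\<le>Suc t. A i) \<le> card (\<Union>i\<le>t. A i) + card (A (Suc t) - A t)"
      by (metis card_Un_le)
    with Suc step[of t] show ?case
      by simp
  qed
  have "card (pverts G) * (card (pverts G) - 1) = card (Sigma (pverts G) (\<lambda>a. pverts G - {a}))"
    by (simp add: card_SigmaI pair_finite_verts)
  also have "\<dots> \<le> card (\<Union>i\<le>length Ms. A i)"
    using acq fin
    by (intro card_mono) (auto, fastforce simp: A_def acquaintance_strategy_def acquainted_def)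
  finally show ?thesis
    using union[of "length Ms"] by simp
qed

lemma (in pair_graph) card_incident_arcs_le:
  "card {(u, v) \<in> parcs G. u = w \<or> v = w} \<le> 2 * card {v. (w, v) \<in> parcs G}"
proof -
  let ?D = "{v. (w, v) \<in> parcs G}"
  have fin: "finite ?D"
    using pair_finite_verts by (rule finite_subset[rotated]) (auto dest: in_arcsD2)
  have "{(u, v) \<in> parcs G. u = w \<or> v = w} \<subseteq> Pair w ` ?D \<union> (\<lambda>v. (v, w)) ` ?D"
    using arcs_symmetric by auto
  then have "card {(u, v) \<in> parcs G. u = w \<or> v = w} \<le> card (Pair w ` ?D \<union> (\<lambda>v. (v, w)) ` ?D)"
    using fin by (intro card_mono) auto
  also have "\<dots> \<le> card (Pair w ` ?D) + card ((\<lambda>v. (v, w)) ` ?D)"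
    by (rule card_Un_le)
  also have "\<dots> \<le> 2 * card ?D"
    using card_image_le[OF fin, of "Pair w"] card_image_le[OF fin, of "\<lambda>v. (v, w)"] by linarith
  finally show ?thesis .
qed

section \<open>Graphs on an initial segment of the naturals\<close>

text \<open>Symmetry and irreflexivity are forced here, so any relation gives a simple graph and
  edges at vertex 0 can be described from one side only.\<close>

definition graph_on :: "nat \<Rightarrow> (nat \<Rightarrow> nat \<Rightarrow> bool) \<Rightarrow> nat pair_pre_digraph" where
  "graph_on n E = \<lparr>pverts = {..<n}, parcs = {(u, v). u < n \<and> v < n \<and> u \<noteq> v \<and> (E u v \<or> E v u)}\<rparr>"

lemma pverts_graph_on [simp]: "pverts (graph_on n E) = {..<n}"
  by (simp add: graph_on_def)

lemma parcs_graph_on: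
  "(u, v) \<in> parcs (graph_on n E) \<longleftrightarrow> u < n \<and> v < n \<and> u \<noteq> v \<and> (E u v \<or> E v u)"
  by (simp add: graph_on_def)

lemma pair_graph_graph_on: "pair_graph (graph_on n E)"
proof
  show "finite (parcs (graph_on n E))"
    by (rule finite_subset[of _ "{..<n} \<times> {..<n}"]) (auto simp: graph_on_def)
qed (auto simp: graph_on_def symmetric_def sym_def)

lemma connected_graph_on:
  assumes "n \<ge> 1" "\<And>v. v < n \<Longrightarrow> (v, 0) \<in> (parcs (graph_on n E))\<^sup>*"
  shows "Digraph_Component.connected (with_proj (graph_on n E))"
proof -
  let ?R = "parcs (graph_on n E)"
  interpret pair_graph "graph_on n E"
    by (rule pair_graph_graph_on)
  have "(u, v) \<in> ?R\<^sup>*" if "u < n" "v < n" for u v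
  proof -
    have "sym (?R\<^sup>*)"
      using arcs_symmetric by (intro sym_rtrancl) (auto simp: sym_def)
    then have "(0, v) \<in> ?R\<^sup>*"
      using assms(2)[OF that(2)] by (rule symD)
    with assms(2)[OF that(1)] show ?thesis
      by (rule rtrancl_trans)
  qed
  then have "u \<rightarrow>\<^sup>*\<^bsub>with_proj (graph_on n E)\<^esub> v" if "u < n" "v < n" for u v
    using that by (simp add: reachable_conv)
  then have "u \<rightarrow>\<^sup>*\<^bsub>mk_symmetric (with_proj (graph_on n E))\<^esub> v" if "u < n" "v < n" for u v
    using that by (intro reachable_mk_symmetricI) auto
  then show ?thesis
    using assms(1)
    by (auto simp: connected_def strongly_connected_def lessThan_empty_iff)
qed

section \<open>A clique with pendant vertices\<close>

text \<open>The pendant vertices are 1, ..., m; the clique consists of 0 and the vertices above m.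
  The extremes m = 0 and m = n - 1 are the complete graph and the star.\<close>

definition pendant_clique :: "nat \<Rightarrow> nat \<Rightarrow> nat pair_pre_digraph" where
  "pendant_clique n m = graph_on n (\<lambda>u v. u = 0 \<or> m < u \<and> m < v)"

lemma pair_graph_pendant_clique: "pair_graph (pendant_clique n m)"
  by (simp add: pendant_clique_def pair_graph_graph_on)

lemma connected_pendant_clique:
  assumes "n \<ge> 1"
  shows "Digraph_Component.connected (with_proj (pendant_clique n m))"
  unfolding pendant_clique_def
proof (rule connected_graph_on[OF assms])
  fix v assume "v < n"
  then have "v = 0 \<or> (v, 0) \<in> parcs (graph_on n (\<lambda>u v. u = 0 \<or> m < u \<and> m < v))"
    by (auto simp: parcs_graph_on)
  then show "(v, 0) \<in> (parcs (graph_on n (\<lambda>u v. u = 0 \<or> m < u \<and> m < v)))\<^sup>*"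
    by auto
qed

lemma pendant_clique_strategy:
  assumes "m < n"
  shows "\<exists>Ms. acquaintance_strategy (pendant_clique n m) Ms \<and> length Ms = 2 * m"
proof -
  interpret pair_graph "pendant_clique n m"
    by (rule pair_graph_pendant_clique)
  define E where "E x = [single_swap x 0, single_swap x 0]" for x :: nat
  define Es where "Es = map E [1..<Suc m]"
  have ex: "strategy (pendant_clique n m) (E x) \<and> fold swap_along (E x) = id"
    if "x \<in> {1..m}" for x
    using that assms
    by (auto simp: E_def strategy_def swap_along_single_swap pendant_clique_def parcs_graph_on
        intro!: matching_single_swap)
  \<comment> \<open>At time 1 agent x stands at 0 while b is still at home. Agent 0, which x
    displaces, is adjacent to everyone from the start.\<close>
  have leaf: "acquainted (pendant_clique n m) (E x) x b"
    if "x \<in> {1..m}" "b < n" "b \<noteq> x" "b \<noteq> 0" for x b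
    unfolding acquainted_def using that assms
    by (intro exI[of _ 1])
       (auto simp: position_def E_def swap_along_single_swap pendant_clique_def parcs_graph_on)
  have "acquaintance_strategy (pendant_clique n m) (concat Es)"
  proof (rule acquaintance_strategy_concat)
    show "strategy (pendant_clique n m) F \<and> fold swap_along F = id" if "F \<in> set Es" for F
      using that ex by (auto simp: Es_def simp del: upt_Suc)
    fix a b
    assume ab: "a \<in> pverts (pendant_clique n m)" "b \<in> pverts (pendant_clique n m)" "a \<noteq> b"
      "(a, b) \<notin> parcs (pendant_clique n m)"
    then have "a \<noteq> 0" "b \<noteq> 0" "a \<in> {1..m} \<or> b \<in> {1..m}"
      by (auto simp: pendant_clique_def parcs_graph_on)
    with ab have "\<exists>x\<in>{1..m}. acquainted (pendant_clique n m) (E x) a b \<or>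
        acquainted (pendant_clique n m) (E x) b a"
      using leaf[of a b] leaf[of b a] by (auto simp: pendant_clique_def)
    then show "\<exists>F\<in>set Es. acquainted (pendant_clique n m) F a b \<or>
        acquainted (pendant_clique n m) F b a"
      by (auto simp: Es_def simp del: upt_Suc)
  qed
  moreover have "length (concat Es) = 2 * m"
    by (simp add: Es_def E_def length_concat o_def sum_list_triv del: upt_Suc)
  ultimately show ?thesis
    by blast
qed

lemma AC_pendant_clique_le: "m < n \<Longrightarrow> AC (pendant_clique n m) \<le> 2 * m"
  using pendant_clique_strategy AC_le by metis

text \<open>A pendant vertex can only be left through the hub \<open>0\<close>, so each round releases at most one agent.\<close>

lemma pendant_clique_strategy_length:
  assumes "acquaintance_strategy (pendant_clique n m) Ms" "m < n"
  shows "m \<le> length Ms + 1"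
proof (rule ccontr)
  let ?G = "pendant_clique n m"
  interpret pair_graph ?G
    by (rule pair_graph_pendant_clique)
  assume "\<not> m \<le> length Ms + 1"
  then have long: "length Ms + 2 \<le> m"
    by simp
  have m: "matching ?G (Ms ! t)" if "t < length Ms" for t
    using assms(1) that by (simp add: acquaintance_strategy_def strategy_def)
  define R where "R t = {a. {a, 0} \<in> Ms ! t}" for t
  have R: "finite (R t) \<and> card (R t) \<le> 1" if "t < length Ms" for t
  proof -
    have "a = b" if "a \<in> R t" "b \<in> R t" for a b
      using that doubleton_in_matching_unique[OF m[OF \<open>t < length Ms\<close>], of 0 a b]
      by (simp add: R_def insert_commute)
    then show ?thesis
      by (metis card_le_Suc0_iff_eq One_nat_def finite.emptyI finite.insertI finite_subset insertI1
          subsetI ex_in_conv)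
  qed
  define U where "U = {1..m} - (\<Union>t<length Ms. R t)"
  have "card (\<Union>t<length Ms. R t) \<le> (\<Sum>t<length Ms. card (R t))"
    by (rule card_UN_le) simp
  also have "\<dots> \<le> (\<Sum>t<length Ms. 1)"
    using R by (intro sum_mono) auto
  finally have "card (\<Union>t<length Ms. R t) \<le> length Ms"
    by simp
  moreover have "card {1..m} - card (\<Union>t<length Ms. R t) \<le> card U"
    unfolding U_def using R by (intro diff_card_le_card_Diff) auto
  ultimately have "2 \<le> card U"
    using long by simp
  then obtain a b where ab: "a \<in> U" "b \<in> U" "a \<noteq> b"
    by (metis card_le_Suc0_iff_eq card.infinite not_less_eq_eq numeral_2_eq_2 zero_le)
  have stay: "position Ms t x = x" if "x \<in> U" "t \<le> length Ms" for x t
    using that(2)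
  proof (induction t)
    case (Suc t)
    then have t: "t < length Ms"
      by simp
    have "swap_along (Ms ! t) x = x"
      using m[OF t]
    proof (cases rule: swap_along_cases[where v = x])
      case 2
      then have "swap_along (Ms ! t) x = 0"
        using matching_arc[OF m[OF t] 2] that(1)
        by (auto simp: U_def pendant_clique_def parcs_graph_on)
      with 2 t that(1) show ?thesis
        by (auto simp: U_def R_def)
    qed
    with Suc t show ?case
      by (simp add: position_Suc)
  qed simp
  have "acquainted ?G Ms a b"
    using assms ab by (auto simp: acquaintance_strategy_def U_def pendant_clique_def)
  with stay ab show False
    by (auto simp: acquainted_def U_def pendant_clique_def parcs_graph_on)
qed

text \<open>The bound m - 1 is void at m = 1, so zero rounds are excluded separately: for m > 0 the
  vertices 1 and 2 exist and are not adjacent.\<close>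

lemma AC_pendant_clique_ge:
  assumes "m < n" "3 \<le> n"
  shows "m \<le> 2 * AC (pendant_clique n m)"
proof -
  obtain Ms where Ms: "acquaintance_strategy (pendant_clique n m) Ms"
    "length Ms = AC (pendant_clique n m)"
    using pendant_clique_strategy[OF assms(1)] obtain_optimal_strategy by metis
  have "AC (pendant_clique n m) \<noteq> 0" if "m \<noteq> 0"
  proof
    assume "AC (pendant_clique n m) = 0"
    with Ms have "acquaintance_strategy (pendant_clique n m) []"
      by simp
    then have "(1, 2) \<in> parcs (pendant_clique n m)"
      using assms by (auto simp: acquaintance_strategy_def acquainted_def pendant_clique_def)
    with that show False
      by (auto simp: pendant_clique_def parcs_graph_on)
  qed
  with pendant_clique_strategy_length[OF Ms(1) assms(1)] Ms(2) show ?thesis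
    by (cases "m = 0") auto
qed

section \<open>Cliques attached to a hub\<close>

text \<open>The vertices other than the hub 0, shifted down by one, are cut into blocks of s
  consecutive numbers, the last one possibly shorter. Each block is a clique whose first vertex is
  joined to the hub.\<close>

definition hub_graph :: "nat \<Rightarrow> nat \<Rightarrow> nat pair_pre_digraph" where
  "hub_graph n s = graph_on n
     (\<lambda>u v. if u = 0 then s dvd v - 1 else v \<noteq> 0 \<and> (u - 1) div s = (v - 1) div s)"

text \<open>The gateway of the clique of v. The value 0 at the hub lets the route from v through its
  port to 0 degenerate to standing still.\<close>

definition port :: "nat \<Rightarrow> nat \<Rightarrow> nat" where
  "port s v = (if v = 0 then 0 else Suc ((v - 1) div s * s))"

text \<open>The last block index may overshoot the vertex set; the filter removes such
  candidates.\<close>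

definition ports :: "nat \<Rightarrow> nat \<Rightarrow> nat list" where
  "ports n s = filter (\<lambda>v. v < n) (map (\<lambda>j. Suc (j * s)) [0..<Suc (n div s)])"

lemma pverts_hub_graph [simp]: "pverts (hub_graph n s) = {..<n}"
  by (simp add: hub_graph_def)

lemma parcs_hub_graph:
  "(u, v) \<in> parcs (hub_graph n s) \<longleftrightarrow> u < n \<and> v < n \<and> u \<noteq> v \<and>
     (if u = 0 then s dvd v - 1 else if v = 0 then s dvd u - 1 else (u - 1) div s = (v - 1) div s)"
  by (auto simp: hub_graph_def parcs_graph_on)

lemma pair_graph_hub_graph: "pair_graph (hub_graph n s)"
  by (simp add: hub_graph_def pair_graph_graph_on)

lemma port_0 [simp]: "port s 0 = 0"
  by (simp add: port_def)

lemma port_eq_0_iff [simp]: "port s v = 0 \<longleftrightarrow> v = 0"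
  by (simp add: port_def)

lemma port_le: "port s v \<le> v"
proof (cases v)
  case (Suc w)
  have "w div s * s \<le> w"
    by (rule div_times_less_eq_dividend)
  with Suc show ?thesis
    by (simp add: port_def)
qed simp

lemma dvd_port: "s dvd port s v - 1"
  by (simp add: port_def)

lemma port_div: "s > 0 \<Longrightarrow> (port s v - 1) div s = (v - 1) div s"
  by (simp add: port_def)

lemma arc_port:
  assumes "s > 0" "v < n"
  shows "v = port s v \<or> (v, port s v) \<in> parcs (hub_graph n s)"
  using assms port_le[of s v] port_div[of s v] by (auto simp: parcs_hub_graph)

lemma arc_port_hub:
  assumes "v < n"
  shows "port s v = 0 \<or> (port s v, 0) \<in> parcs (hub_graph n s)"
  using assms port_le[of s v] dvd_port[of s v] by (auto simp: parcs_hub_graph)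

lemma length_ports: "length (ports n s) \<le> n div s + 1"
  unfolding ports_def by (rule order_trans[OF length_filter_le]) simp

lemma port_in_ports:
  assumes "v < n" "v \<noteq> 0"
  shows "port s v \<in> set (ports n s)"
proof -
  have "(v - 1) div s \<le> n div s"
    using assms by (intro div_le_mono) simp
  moreover have "port s v < n"
    using port_le[of s v] assms by simp
  ultimately show ?thesis
    using assms by (auto simp: ports_def port_def simp del: upt_Suc)
qed

lemma set_ports: "q \<in> set (ports n s) \<Longrightarrow> q < n \<and> q \<noteq> 0 \<and> s dvd q - 1"
  by (auto simp: ports_def simp del: upt_Suc)

lemma connected_hub_graph:
  assumes "n \<ge> 1" "s > 0"
  shows "Digraph_Component.connected (with_proj (hub_graph n s))"
proof -
  have "(v, 0) \<in> (parcs (hub_graph n s))\<^sup>*" if v: "v < n" for v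
  proof -
    have "(v, port s v) \<in> (parcs (hub_graph n s))\<^sup>*"
      using arc_port[OF assms(2) v] by auto
    moreover have "(port s v, 0) \<in> (parcs (hub_graph n s))\<^sup>*"
      using arc_port_hub[OF v, of s] by auto
    ultimately show ?thesis
      by (rule rtrancl_trans)
  qed
  with assms(1) show ?thesis
    unfolding hub_graph_def by (rule connected_graph_on)
qed

section \<open>Upper bound for the hub graph\<close>

text \<open>Every agent visits every clique and walks back, which restores the initial placement.\<close>

lemma hub_graph_strategy:
  assumes "s > 0"
  shows "\<exists>Ms. acquaintance_strategy (hub_graph n s) Ms \<and> length Ms \<le> 6 * n * (n div s + 1)"
proof -
  let ?G = "hub_graph n s"
  interpret pair_graph ?G
    by (rule pair_graph_hub_graph)
  \<comment> \<open>Home to port to hub to the port q, then the same swaps in reverse: a palindrome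
    of transpositions composes to the identity.\<close>
  define E where "E a q = [single_swap a (port s a), single_swap (port s a) 0, single_swap 0 q,
    single_swap 0 q, single_swap (port s a) 0, single_swap a (port s a)]" for a q
  define Es where "Es = map (\<lambda>(a, q). E a q) (List.product [0..<n] (ports n s))"
  have ex: "strategy ?G (E a q) \<and> fold swap_along (E a q) = id"
    if "a < n" "q \<in> set (ports n s)" for a q
  proof
    have "(0, q) \<in> parcs ?G"
      using set_ports[OF that(2)] that(1) by (auto simp: parcs_hub_graph)
    then show "strategy ?G (E a q)"
      using arc_port[OF assms that(1)] arc_port_hub[OF that(1), of s]
      by (auto simp: E_def strategy_def intro!: matching_single_swap)
    show "fold swap_along (E a q) = id"
      by (simp add: E_def swap_along_single_swap fun_eq_iff)
  qed
  have visit: "acquainted ?G (E a (port s b)) a b"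
    if ab: "a < n" "b < n" "a \<noteq> b" "b \<noteq> 0" "(a, b) \<notin> parcs ?G" for a b
  proof -
    have far: "a = 0 \<or> (a - 1) div s \<noteq> (b - 1) div s"
      using ab by (auto simp: parcs_hub_graph)
    have ne: "b \<noteq> port s a" "port s a \<noteq> port s b" "a \<noteq> port s b"
      using far ab(4) port_div[OF assms, of a] port_div[OF assms, of b] by auto
    have two: "position (E a (port s b)) 2 a = 0" "position (E a (port s b)) 2 b = b"
      using ab ne by (auto simp: position_def E_def swap_along_single_swap transpose_def)
    have three: "position (E a (port s b)) 3 a = port s b"
      using ab ne by (auto simp: position_def E_def swap_along_single_swap transpose_def)
    \<comment> \<open>The third swap displaces b exactly when b lives at its port, but then a
      already meets it from the hub at time 2.\<close>
    show ?thesis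
    proof (cases "b = port s b")
      case True
      then have "(0, b) \<in> parcs ?G"
        using dvd_port[of s b] ab by (auto simp: parcs_hub_graph)
      with two show ?thesis
        unfolding acquainted_def by (intro exI[of _ 2]) (simp add: E_def)
    next
      case False
      then have "position (E a (port s b)) 3 b = b"
        using ab ne by (auto simp: position_def E_def swap_along_single_swap transpose_def)
      moreover have "(port s b, b) \<in> parcs ?G"
        using arc_port[OF assms ab(2)] False arcs_symmetric by auto
      ultimately show ?thesis
        using three unfolding acquainted_def by (intro exI[of _ 3]) (simp add: E_def)
    qed
  qed
  have "acquaintance_strategy ?G (concat Es)"
  proof (rule acquaintance_strategy_concat)
    show "strategy ?G F \<and> fold swap_along F = id" if "F \<in> set Es" for F
      using that ex by (auto simp: Es_def)
    have mem: "E a (port s b) \<in> set Es" if "a < n" "b < n" "b \<noteq> 0" for a b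
      using that port_in_ports by (force simp: Es_def)
    fix a b
    assume ab: "a \<in> pverts ?G" "b \<in> pverts ?G" "a \<noteq> b" "(a, b) \<notin> parcs ?G"
    then have "(b, a) \<notin> parcs ?G"
      using arcs_symmetric by blast
    \<comment> \<open>If b is the hub, then its agent visits the clique of a instead.\<close>
    with ab show "\<exists>F\<in>set Es. acquainted ?G F a b \<or> acquainted ?G F b a"
      using visit[of a b] visit[of b a] mem[of a b] mem[of b a] by (cases "b = 0") auto
  qed
  moreover have "length (concat Es) = 6 * n * length (ports n s)"
    by (simp add: Es_def E_def length_concat o_def sum_list_triv case_prod_unfold)
  then have "length (concat Es) \<le> 6 * n * (n div s + 1)"
    using length_ports[of n s] by (metis mult_le_mono2)
  ultimately show ?thesis
    by blast
qed

lemma AC_hub_graph_le: "s > 0 \<Longrightarrow> AC (hub_graph n s) \<le> 6 * n * (n div s + 1)"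
  using hub_graph_strategy AC_le order_trans by metis

section \<open>Lower bound for the hub graph: degrees and new adjacencies\<close>

lemma hub_degree_le: "card {v. (0, v) \<in> parcs (hub_graph n s)} \<le> n div s + 1"
proof -
  have "v \<in> set (ports n s)" if "(0, v) \<in> parcs (hub_graph n s)" for v
  proof -
    have v: "v < n" "v \<noteq> 0" "s dvd v - 1"
      using that by (auto simp: parcs_hub_graph)
    then have "port s v = v"
      by (simp add: port_def)
    with port_in_ports[OF v(1,2), of s] show ?thesis
      by simp
  qed
  then have "card {v. (0, v) \<in> parcs (hub_graph n s)} \<le> card (set (ports n s))"
    by (intro card_mono subsetI) auto
  also have "\<dots> \<le> n div s + 1"
    using card_length length_ports order_trans by blast
  finally show ?thesis .
qed

lemma nonhub_degree_le:
  assumes "s > 0" "w \<noteq> 0"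
  shows "card {v. (w, v) \<in> parcs (hub_graph n s)} \<le> s + 1"
proof -
  let ?A = "(\<lambda>i. Suc ((w - 1) div s * s + i)) ` {..<s}"
  have "v \<in> insert 0 ?A" if "(w, v) \<in> parcs (hub_graph n s)" for v
  proof (cases "v = 0")
    case False
    then have "(w - 1) div s = (v - 1) div s"
      using that assms by (simp add: parcs_hub_graph)
    then have "v = Suc ((w - 1) div s * s + (v - 1) mod s)"
      using False by simp
    with assms show ?thesis
      by (metis image_eqI insertI2 lessThan_iff mod_less_divisor)
  qed simp
  then have "card {v. (w, v) \<in> parcs (hub_graph n s)} \<le> card (insert 0 ?A)"
    by (intro card_mono) auto
  also have "\<dots> \<le> s + 1"
    using card_image_le[of "{..<s}" "\<lambda>i. Suc ((w - 1) div s * s + i)"]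
    by (simp add: card_insert_if)
  finally show ?thesis .
qed

lemma card_parcs_hub_graph_le:
  assumes "s > 0"
  shows "card (parcs (hub_graph n s)) \<le> (n div s + 1) + n * (s + 1)"
proof -
  let ?N = "\<lambda>u. {v. (u, v) \<in> parcs (hub_graph n s)}"
  have "finite (?N u)" for u
    by (rule finite_subset[of _ "{..<n}"]) (auto simp: parcs_hub_graph)
  then have "card (Sigma {..<n} ?N) = (\<Sum>u<n. card (?N u))"
    by (simp add: card_SigmaI)
  moreover have "Sigma {..<n} ?N = parcs (hub_graph n s)"
    by (auto simp: parcs_hub_graph)
  ultimately have "card (parcs (hub_graph n s)) = (\<Sum>u<n. card (?N u))"
    by simp
  \<comment> \<open>The hub receives both degree bounds, which keeps the remaining summand
    constant.\<close>
  also have "\<dots> \<le> (\<Sum>u<n. (if u = 0 then n div s + 1 else 0) + (s + 1))"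
    using hub_degree_le[of n s] nonhub_degree_le[OF assms] by (intro sum_mono) (auto simp: trans_le_add1)
  also have "\<dots> \<le> (n div s + 1) + n * (s + 1)"
    by (simp add: sum.distrib sum.delta del: add_Suc add_Suc_right)
  finally show ?thesis .
qed

text \<open>
  A pair of adjacent agents other than the one at the hub and the one moving into it stays
  inside a clique, so only those two agents can gain acquaintances in a round.
\<close>

lemma hub_graph_new_arcs_le:
  assumes "s > 0" and M: "matching (hub_graph n s) M"
  shows "card {(u, v) \<in> parcs (hub_graph n s).
      (swap_along M u, swap_along M v) \<notin> parcs (hub_graph n s)} \<le> 2 * (n div s + 1) + 2 * (s + 1)"
    (is "card ?N \<le> _")
proof -
  let ?G = "hub_graph n s"
  interpret pair_graph ?G
    by (rule pair_graph_hub_graph)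
  \<comment> \<open>The vertex exchanged with the hub in this round, or 0 if the hub is unmatched.
    Every other agent stays in its clique.\<close>
  define w where "w = swap_along M 0"
  define I where "I x = {(u, v) \<in> parcs ?G. u = x \<or> v = x}" for x
  have fin: "finite (I x)" for x
    unfolding I_def by (rule finite_subset[OF _ pair_finite_arcs]) auto
  have inside: "swap_along M u \<noteq> 0 \<and> (swap_along M u - 1) div s = (u - 1) div s"
    if "u \<noteq> 0" "u \<noteq> w" for u
  proof -
    have ne: "swap_along M u \<noteq> 0"
      using that swap_along_involution[OF M, of u] by (metis w_def)
    show ?thesis
      using M
    proof (cases rule: swap_along_cases[where v = u])
      case 2
      with matching_arc[OF M 2] ne that show ?thesis
        by (simp add: parcs_hub_graph)
    qed (use that in simp)
  qed
  have "?N \<subseteq> I 0 \<union> I w"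
  proof clarify
    fix u v
    assume uv: "(u, v) \<in> parcs ?G" "(swap_along M u, swap_along M v) \<notin> parcs ?G" "(u, v) \<notin> I w"
    show "(u, v) \<in> I 0"
    proof (rule ccontr)
      assume "(u, v) \<notin> I 0"
      with uv have "u \<noteq> 0" "v \<noteq> 0" "u \<noteq> w" "v \<noteq> w"
        by (auto simp: I_def)
      moreover have "swap_along M u \<noteq> swap_along M v"
        using uv(1) inj_swap_along[OF M] by (auto simp: parcs_hub_graph inj_eq)
      moreover have "swap_along M u < n" "swap_along M v < n"
        using swap_along_in_pverts[OF M] in_arcsD1[OF uv(1)] in_arcsD2[OF uv(1)] by auto
      ultimately have "(swap_along M u, swap_along M v) \<in> parcs ?G"
        using inside[of u] inside[of v] uv(1) by (simp add: parcs_hub_graph)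
      with uv(2) show False
        by contradiction
    qed
  qed
  then have le: "card ?N \<le> card (I 0 \<union> I w)"
    using fin by (intro card_mono) auto
  have I0: "card (I 0) \<le> 2 * (n div s + 1)"
    unfolding I_def using card_incident_arcs_le[of 0] hub_degree_le[of n s]
    by (meson mult_le_mono2 order_trans)
  \<comment> \<open>If the hub is unmatched, \<open>I w\<close> is \<open>I 0\<close>, and the
    degree bound for vertices other than the hub does not apply.\<close>
  show ?thesis
  proof (cases "w = 0")
    case True
    with le I0 show ?thesis
      by simp
  next
    case False
    have "card (I w) \<le> 2 * (s + 1)"
      unfolding I_def using card_incident_arcs_le[of w] nonhub_degree_le[OF assms(1) False, of n]
      by (meson mult_le_mono2 order_trans)
    with le I0 card_Un_le[of "I 0" "I w"] show ?thesis
      by linarith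
  qed
qed

lemma AC_hub_graph_ge:
  assumes "s > 0"
  shows "n * (n - 1) \<le> (n div s + 1) + n * (s + 1) +
           AC (hub_graph n s) * (2 * (n div s + 1) + 2 * (s + 1))"
proof -
  interpret pair_graph "hub_graph n s"
    by (rule pair_graph_hub_graph)
  obtain Ms where Ms: "acquaintance_strategy (hub_graph n s) Ms" "length Ms = AC (hub_graph n s)"
    using hub_graph_strategy[OF assms] obtain_optimal_strategy by metis
  from card_pairs_le[OF Ms(1) hub_graph_new_arcs_le[OF assms]] card_parcs_hub_graph_le[OF assms, of n]
  show ?thesis
    by (simp add: Ms(2))
qed

section \<open>Choice of the clique size and the resulting constants\<close>

text \<open>Balances the hub degree, about \<open>f / n\<close>, against the clique size, about \<open>n\<^sup>2 / f\<close>.\<close>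

lemma AC_hub_graph_bounds:
  fixes n f :: nat
  defines "s \<equiv> n\<^sup>2 div (8 * f)"
  assumes n: "64 \<le> n" and f: "n \<le> f" "real f \<le> real n powr (3/2)"
  shows "s > 0" "real (AC (hub_graph n s)) \<le> 102 * real f" "real f \<le> 74 * real (AC (hub_graph n s))"
proof -
  define N F where "N = real n" and "F = real f"
  have N: "64 \<le> N" and F: "N \<le> F"
    using n f by (simp_all add: N_def F_def)
  \<comment> \<open>The growth hypothesis on f enters only in this squared form: once for s > 0 and
    once to bound F * D.\<close>
  have F2: "F\<^sup>2 \<le> N ^ 3"
  proof -
    have "F\<^sup>2 \<le> (N powr (3/2))\<^sup>2"
      using f(2) unfolding N_def F_def by (intro power_mono) auto
    also have "\<dots> = N powr 3"
      using N by (simp add: power2_eq_square flip: powr_add)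
    also have "\<dots> = N ^ 3"
      using N by (simp add: powr_numeral)
    finally show ?thesis .
  qed
  \<comment> \<open>Here n >= 64 absorbs the square of 8, so the quotient defining s does not round
    down to 0.\<close>
  have "(8 * F)\<^sup>2 \<le> (N\<^sup>2)\<^sup>2"
  proof -
    have "(8 * F)\<^sup>2 \<le> 64 * N ^ 3"
      using F2 by (simp add: power_mult_distrib)
    also have "\<dots> \<le> N * N ^ 3"
      using N by (intro mult_right_mono) auto
    finally show ?thesis
      by (simp add: power2_eq_square power3_eq_cube algebra_simps)
  qed
  then have eight: "8 * F \<le> N\<^sup>2"
    by (rule power2_le_imp_le) simp
  then have "8 * f \<le> n\<^sup>2"
    unfolding F_def N_def by (metis of_nat_le_iff of_nat_mult of_nat_numeral of_nat_power)
  moreover have "0 < 8 * f"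
    using n f by simp
  ultimately show s: "s > 0"
    unfolding s_def by (simp add: div_greater_zero_iff)
  define S D A where "S = real s" and "D = real (n div s)" and "A = real (AC (hub_graph n s))"
  have S1: "1 \<le> S"
    using s by (simp add: S_def)
  have S_up: "8 * F * S \<le> N\<^sup>2"
  proof -
    have "8 * f * s \<le> n\<^sup>2"
      unfolding s_def by simp
    then have "real (8 * f * s) \<le> real (n\<^sup>2)"
      by (rule of_nat_mono)
    then show ?thesis
      by (simp add: F_def S_def N_def)
  qed
  \<comment> \<open>Rounding costs a factor of at most 2, since s + 1 <= 2 * s.\<close>
  have S_low: "N\<^sup>2 \<le> 16 * F * S"
  proof -
    have "n\<^sup>2 \<le> 8 * f * (s + 1)"
      unfolding s_def using \<open>0 < 8 * f\<close>
      by (metis Suc_eq_plus1 dividend_less_times_div less_imp_le_nat mult_Suc_right add.commute)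
    then have "real (n\<^sup>2) \<le> real (8 * f * (s + 1))"
      by (rule of_nat_mono)
    then have "N\<^sup>2 \<le> 8 * F * (S + 1)"
      by (simp add: F_def S_def N_def algebra_simps)
    also have "\<dots> \<le> 8 * F * (2 * S)"
      using S1 F N by (intro mult_left_mono) auto
    finally show ?thesis
      by simp
  qed
  have D: "D \<le> N" "D * N \<le> 16 * F"
  proof -
    show "D \<le> N"
      by (simp add: D_def N_def)
    have "D * S \<le> N"
      unfolding D_def S_def N_def by (metis div_times_less_eq_dividend of_nat_le_iff of_nat_mult)
    then have "D * S * (16 * F) \<le> N * (16 * F)"
      using F N by (intro mult_right_mono) auto
    moreover have "D * N\<^sup>2 \<le> D * (16 * F * S)"
      using S_low by (intro mult_left_mono) (auto simp: D_def)
    ultimately have "N * (D * N) \<le> N * (16 * F)"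
      by (simp add: power2_eq_square algebra_simps)
    then show "D * N \<le> 16 * F"
      using N by simp
  qed
  \<comment> \<open>D * N <= 16 * F and N <= F turn the bound into (96 + 6) * F.\<close>
  have "A \<le> real (6 * n * (n div s + 1))"
    unfolding A_def using AC_hub_graph_le[OF s] by (rule of_nat_mono)
  also have "\<dots> = 6 * (D * N) + 6 * N"
    by (simp add: D_def N_def algebra_simps)
  finally show "real (AC (hub_graph n s)) \<le> 102 * real f"
    using D(2) F by (simp add: A_def F_def)
  have low: "N * (N - 1) \<le> (D + 1) + N * (S + 1) + A * (2 * D + 2 * S + 4)"
  proof -
    have "real (n * (n - 1)) \<le> real ((n div s + 1) + n * (s + 1) +
        AC (hub_graph n s) * (2 * (n div s + 1) + 2 * (s + 1)))"
      using AC_hub_graph_ge[OF s] by (rule of_nat_mono)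
    then show ?thesis
      using n by (simp add: N_def D_def S_def A_def of_nat_diff algebra_simps)
  qed
  have "N * (8 * S) \<le> F * (8 * S)"
    using F S1 by (intro mult_right_mono) auto
  then have NS: "8 * (N * S) \<le> N\<^sup>2"
    using S_up by (simp add: algebra_simps)
  have N2: "64 * N \<le> N\<^sup>2"
    using N by (simp add: power2_eq_square)
  \<comment> \<open>The terms free of A, together with the N subtracted on the left, total at most N
    * S + 3 * N + 1. By \<open>NS\<close> and \<open>N2\<close> this is below half of N^2.\<close>
  have "N\<^sup>2 \<le> 2 * (A * (2 * D + 2 * S + 4))"
  proof -
    have "N * (N - 1) = N\<^sup>2 - N" "N * (S + 1) = N * S + N"
      by (simp_all add: power2_eq_square algebra_simps)
    with low NS N2 D(1) N show ?thesis
      by linarith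
  qed
  then have "F * N\<^sup>2 \<le> F * (2 * (A * (2 * D + 2 * S + 4)))"
    using F N by (intro mult_left_mono) auto
  also have "\<dots> = 2 * A * (2 * (F * D) + 2 * (F * S) + 4 * F)"
    by (simp add: algebra_simps)
  \<comment> \<open>The three summands are at most 32 N^2, N^2 / 4 and N^2 / 2. Doubling 37 gives
    the final constant 74.\<close>
  also have "\<dots> \<le> 2 * A * (37 * N\<^sup>2)"
  proof -
    have "F * (D * N) \<le> F * (16 * F)"
      using D(2) F N by (intro mult_left_mono) auto
    also have "\<dots> \<le> 16 * N ^ 3"
      using F2 by (simp add: power2_eq_square)
    finally have "N * (F * D) \<le> N * (16 * N\<^sup>2)"
      by (simp add: power2_eq_square power3_eq_cube algebra_simps)
    then have "F * D \<le> 16 * N\<^sup>2"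
      using N by simp
    moreover have "8 * (F * S) \<le> N\<^sup>2"
      using S_up by (simp add: mult.assoc)
    ultimately have "2 * (F * D) + 2 * (F * S) + 4 * F \<le> 37 * N\<^sup>2"
      using eight zero_le_power2[of N] by linarith
    then show ?thesis
      by (intro mult_left_mono) (auto simp: A_def)
  qed
  finally have "N\<^sup>2 * F \<le> N\<^sup>2 * (74 * A)"
    by (simp add: algebra_simps)
  then show "real f \<le> 74 * real (AC (hub_graph n s))"
    using N by (simp add: A_def F_def)
qed

section \<open>Combining the two families\<close>

theorem theorem5p1:
  fixes f :: "nat \<Rightarrow> nat"
  assumes "\<And>n. n \<ge> 1 \<Longrightarrow> real (f n) \<le> real n powr (3/2)"
  shows "\<exists>G :: nat \<Rightarrow> nat pair_pre_digraph.
           (\<forall>n\<ge>1. pair_graph (G n) \<and> Digraph_Component.connected (with_proj (G n)) \<and>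
                  card (pverts (G n)) = n) \<and>
           (\<lambda>n. real (AC (G n))) \<in> \<Theta>(\<lambda>n. real (f n))"
proof -
  \<comment> \<open>The few n < 64 with f n >= n do not affect the asymptotics; the complete graph
    serves there as a connected graph of the right order.\<close>
  define G where "G n = (if f n < n then pendant_clique n (f n)
    else if n < 64 then pendant_clique n 0 else hub_graph n (n\<^sup>2 div (8 * f n)))" for n
  have bounds: "real (AC (G n)) \<le> 102 * real (f n) \<and> real (f n) \<le> 74 * real (AC (G n))"
    if n: "64 \<le> n" for n
  proof (cases "f n < n")
    case True
    then have "AC (G n) \<le> 2 * f n" "f n \<le> 2 * AC (G n)"
      using n AC_pendant_clique_le AC_pendant_clique_ge by (simp_all add: G_def)
    then show ?thesis
      by linarith
  next
    case False
    with n AC_hub_graph_bounds[of n "f n"] assms[of n] show ?thesis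
      by (simp add: G_def)
  qed
  show ?thesis
  proof (intro exI[of _ G] conjI allI impI)
    fix n :: nat assume n: "1 \<le> n"
    show "pair_graph (G n)"
      by (simp add: G_def pair_graph_pendant_clique pair_graph_hub_graph)
    show "Digraph_Component.connected (with_proj (G n))"
      using n AC_hub_graph_bounds(1)[of n "f n"] assms[of n]
      by (auto simp: G_def intro!: connected_pendant_clique connected_hub_graph)
    show "card (pverts (G n)) = n"
      by (simp add: G_def pendant_clique_def)
  next
    show "(\<lambda>n. real (AC (G n))) \<in> \<Theta>(\<lambda>n. real (f n))"
    proof
      show "(\<lambda>n. real (AC (G n))) \<in> O(\<lambda>n. real (f n))"
        by (rule bigoI[of _ 102], rule eventually_sequentiallyI[of 64]) (use bounds in auto)
      show "(\<lambda>n. real (AC (G n))) \<in> \<Omega>(\<lambda>n. real (f n))"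
        unfolding bigomega_iff_bigo
        by (rule bigoI[of _ 74], rule eventually_sequentiallyI[of 64]) (use bounds in auto)
    qed
  qed
qed

end
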